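(* Let $a\ge 0$ and $b\ge 0$ be fixed real numbers with $(a,b)\ne(0,0)$, let $F$ be a continuous cumulative distribution function on $\mathbb{R}$, and let $Q$ be the pseudo-inverse (quantile) function of $F$. Let $\alpha>0$ and $\beta>0$, and suppose $Y_1$ and $Y_2$ are independent random variables with distribution functions $F^\alpha(x)=(F(x))^\alpha$ and $F^\beta(x)=(F(x))^\beta$, respectively. Let $\xi_1$ and $\xi_2$ be independent standard exponential random variables which are also independent from $Y_1$ and $\max\{Y_1,Y_2\}$, respectively. Then $$Y_1+a\xi_1\stackrel{d}{=}\max\{Y_1,Y_2\}-b\xi_2$$ holds if and only if there is a constant $c>0$ (which may be arbitrary) such that $$Q(x)=\log\left\{c\,x^{b\alpha}(1-x^\beta)^{-d}\right\}\qquad\text{for all } 0<x<1,$$ where $d=[a(\alpha+\beta)+b\alpha]/\beta$.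
   Context: $\stackrel{d}{=}$ denotes equality in distribution. A standard exponential variable has cumulative distribution function $1-e^{-t}$ for $t\ge 0$. The pseudo-inverse (quantile) function of $F$ is $Q(y)=\inf\{x:\ F(x)\ge y\}$ for $y\in(0,1)$. $\log$ is the natural logarithm. *)

theory Defs
  imports "HOL-Probability.Probability"
begin

text \<open>
  Meaningful for a cumulative distribution function \<open>F\<close> and \<open>0 < y < 1\<close>: the set below is then
  nonempty and bounded below, as the conditionally complete infimum on the reals requires.
\<close>

definition quantile :: "(real \<Rightarrow> real) \<Rightarrow> real \<Rightarrow> real"
  where "quantile F y = Inf {x. F x \<ge> y}"

end

theory Submission
  imports Defs
begin

text \<open>
  Let \<open>H\<close> be the distribution function of \<open>X + c \<xi>\<close>, where \<open>\<xi>\<close> is standard exponential and independent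
  of \<open>X\<close>, and \<open>X\<close> has continuous distribution function \<open>G\<close>. Then \<open>H\<close> is the only bounded solution of
  \<open>H + c H' = G\<close> (for \<open>c = 0\<close> this reads \<open>H = G\<close>). Hence a common distribution function \<open>H\<close> of both sides satisfies
  \<open>H + a H' = F\<^sup>\<alpha>\<close> and \<open>H - b H' = F\<^sup>\<alpha>\<^sup>+\<^sup>\<beta>\<close>. Eliminating \<open>H'\<close> gives \<open>(a + b) H = p(F)\<close> with
  \<open>p(u) = b u\<^sup>\<alpha> + a u\<^sup>\<alpha>\<^sup>+\<^sup>\<beta>\<close>, and eliminating \<open>H\<close> gives \<open>(a + b) H' = q(F)\<close> with
  \<open>q(u) = u\<^sup>\<alpha> - u\<^sup>\<alpha>\<^sup>+\<^sup>\<beta>\<close>, so equality in distribution is equivalent to the single equation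
  \<open>(p \<circ> F)' = q \<circ> F\<close>. Where \<open>0 < F < 1\<close> this equation separates into \<open>(R \<circ> F)' = 1\<close> with
  \<open>R' = p'/q\<close>, that is, the quantile function is \<open>R\<close> up to an additive constant.
\<close>

section \<open>Distribution functions of exponential shifts and of maxima\<close>

text \<open>Condition on \<open>\<xi> = t\<close>: by Fubini the event becomes
  \<open>Y \<le> x - c * t\<close>. The sign of \<open>c\<close> is left open, so that a negative
  \<open>c\<close> covers the subtraction of an exponential variable.\<close>

lemma (in prob_space) cdf_add_exponential:
  fixes Y \<xi> :: "'a \<Rightarrow> real" and c :: real
  assumes indep: "indep_var borel \<xi> borel Y"
    and exp: "distributed M lborel \<xi> (exponential_density 1)"
  defines "G \<equiv> cdf (distr M borel Y)"
  shows "has_bochner_integral lborel (\<lambda>t. exponential_density 1 t * G (x - c * t))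
    (cdf (distr M borel (\<lambda>\<omega>. Y \<omega> + c * \<xi> \<omega>)) x)"
proof -
  have [measurable]: "random_variable borel \<xi>" "random_variable borel Y"
    and joint: "distr M borel \<xi> \<Otimes>\<^sub>M distr M borel Y
      = distr M (borel \<Otimes>\<^sub>M borel) (\<lambda>\<omega>. (\<xi> \<omega>, Y \<omega>))"
    using indep by (auto simp: indep_var_distribution_eq)
  interpret Y: real_distribution "distr M borel Y" by simp
  have [measurable]: "G \<in> borel_measurable borel"
    unfolding G_def by (intro borel_measurable_mono monoI Y.cdf_nondecreasing)
  have G0: "0 \<le> G y" for y unfolding G_def by (rule Y.cdf_nonneg)
  have dist: "distr M borel \<xi> = density lborel (exponential_density 1)"
    using distributed_distr_eq_density[OF exp] distr_cong[of M M borel lborel \<xi> \<xi>] by simp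
  let ?A = "{z :: real \<times> real. snd z + c * fst z \<le> x}"
  have A: "?A \<in> sets (borel \<Otimes>\<^sub>M borel)"
    unfolding borel_prod by (intro borel_closed closed_Collect_le) (auto intro!: continuous_intros)
  have "emeasure (distr M borel (\<lambda>\<omega>. Y \<omega> + c * \<xi> \<omega>)) {..x}
      = emeasure (distr M (borel \<Otimes>\<^sub>M borel) (\<lambda>\<omega>. (\<xi> \<omega>, Y \<omega>))) ?A"
    using A by (simp add: emeasure_distr) (auto intro!: arg_cong[where f = "emeasure M"])
  also have "\<dots> = (\<integral>\<^sup>+t. emeasure (distr M borel Y) (Pair t -` ?A) \<partial>distr M borel \<xi>)"
    unfolding joint[symmetric] using A by (intro Y.emeasure_pair_measure_alt) simp
  also have "\<dots> = (\<integral>\<^sup>+t. ennreal (G (x - c * t)) \<partial>distr M borel \<xi>)"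
  proof (intro nn_integral_cong)
    fix t :: real
    have "Pair t -` ?A = {..x - c * t}" by auto
    then show "emeasure (distr M borel Y) (Pair t -` ?A) = ennreal (G (x - c * t))"
      by (simp add: G_def cdf_def Y.emeasure_eq_measure)
  qed
  also have "\<dots> = (\<integral>\<^sup>+t. ennreal (exponential_density 1 t * G (x - c * t)) \<partial>lborel)"
    unfolding dist by (subst nn_integral_density) (auto simp: ennreal_mult G0)
  finally have eq: "emeasure (distr M borel (\<lambda>\<omega>. Y \<omega> + c * \<xi> \<omega>)) {..x} = \<dots>" .
  interpret S: real_distribution "distr M borel (\<lambda>\<omega>. Y \<omega> + c * \<xi> \<omega>)" by simp
  show ?thesis
    using eq by (intro has_bochner_integral_nn_integral)
      (auto simp: G0 cdf_def S.emeasure_eq_measure)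
qed

lemma (in prob_space) cdf_max_indep:
  fixes X Y :: "'a \<Rightarrow> real"
  assumes "indep_var borel X borel Y"
  shows "cdf (distr M borel (\<lambda>\<omega>. max (X \<omega>) (Y \<omega>))) x
    = cdf (distr M borel X) x * cdf (distr M borel Y) x"
proof -
  have [measurable]: "random_variable borel X" "random_variable borel Y"
    using assms by (auto simp: indep_var_distribution_eq)
  have "(\<lambda>\<omega>. max (X \<omega>) (Y \<omega>)) -` {..x} = (\<lambda>\<omega>. (X \<omega>, Y \<omega>)) -` ({..x} \<times> {..x})" by auto
  then show ?thesis
    using indep_varD[OF assms, of "{..x}" "{..x}"] by (simp add: cdf_def measure_distr)
qed

section \<open>Exponential averages of a continuous function and their differential equation\<close>

text \<open>The fundamental theorem of calculus on \<open>{0..T}\<close>, followed by T tending to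
  infinity. An average can thus be evaluated through any antiderivative of the integrand in
  \<open>t\<close>; the lemmas below differ in the choice of \<open>\<Phi>\<close>.\<close>

lemma exponential_average_limit:
  fixes G \<Phi> :: "real \<Rightarrow> real"
  assumes int: "has_bochner_integral lborel (\<lambda>t. exponential_density 1 t * G (x - c * t)) I"
    and cont: "continuous_on UNIV G"
    and deriv: "\<And>t. (\<Phi> has_real_derivative exp (- t) * G (x - c * t)) (at t)"
  shows "((\<lambda>T. \<Phi> T - \<Phi> 0) \<longlongrightarrow> I) at_top"
proof -
  let ?f = "\<lambda>t. exponential_density 1 t * G (x - c * t)"
  have G: "isCont G y" for y
    using cont by (simp add: continuous_on_eq_continuous_at)
  have "((\<lambda>T. \<integral>t. indicator {..T} t *\<^sub>R ?f t \<partial>lborel) \<longlongrightarrow> (\<integral>t. ?f t \<partial>lborel)) at_top"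
    using int by (intro tendsto_integral_at_top) (auto simp: has_bochner_integral_iff)
  moreover have "(\<integral>t. ?f t \<partial>lborel) = I"
    using int by (simp add: has_bochner_integral_iff)
  moreover have "\<forall>\<^sub>F T in at_top. (\<integral>t. indicator {..T} t *\<^sub>R ?f t \<partial>lborel) = \<Phi> T - \<Phi> 0"
    using eventually_ge_at_top[of 0]
  proof eventually_elim
    case (elim T)
    have "(\<integral>t. indicator {..T} t *\<^sub>R ?f t \<partial>lborel)
        = (\<integral>t. exp (- t) * G (x - c * t) * indicator {0..T} t \<partial>lborel)"
      by (intro Bochner_Integration.integral_cong)
        (auto simp: exponential_density_def indicator_def)
    also have "\<dots> = \<Phi> T - \<Phi> 0"
      using elim by (intro integral_FTC_Icc_real deriv) (auto intro!: continuous_intros isCont_o2[OF _ G])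
    finally show ?case .
  qed
  ultimately show ?thesis
    by (auto intro: Lim_transform_eventually)
qed

text \<open>By the differential equation, \<open>- (exp (- t) * W (x - c * t))\<close> is an
  antiderivative of the integrand. Boundedness of \<open>W\<close> removes its boundary term at
  infinity, and the one at 0 contributes \<open>W x\<close>.\<close>

lemma exponential_average_unique:
  fixes G W :: "real \<Rightarrow> real"
  assumes int: "has_bochner_integral lborel (\<lambda>t. exponential_density 1 t * G (x - c * t)) I"
    and cont: "continuous_on UNIV G"
    and deriv: "\<And>y. (W has_real_derivative W' y) (at y)"
    and ode: "\<And>y. W y + c * W' y = G y"
    and bounded: "\<And>y. \<bar>W y\<bar> \<le> B"
  shows "I = W x"
proof -
  define \<Phi> where "\<Phi> t = - (exp (- t) * W (x - c * t))" for t
  have "((\<lambda>T. \<Phi> T - \<Phi> 0) \<longlongrightarrow> I) at_top"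
  proof (rule exponential_average_limit[OF int cont])
    fix t
    have "((\<lambda>t. W (x - c * t)) has_real_derivative W' (x - c * t) * (- c)) (at t)"
      by (rule DERIV_chain2[OF deriv]) (auto intro!: derivative_eq_intros)
    then show "(\<Phi> has_real_derivative exp (- t) * G (x - c * t)) (at t)"
      unfolding \<Phi>_def ode[symmetric]
      by (auto intro!: derivative_eq_intros simp: algebra_simps)
  qed
  moreover have "((\<lambda>T. exp (- T) * W (x - c * T)) \<longlongrightarrow> 0) at_top"
  proof (rule tendsto_0_le[where K = B])
    show "((\<lambda>T. exp (- T)) \<longlongrightarrow> (0 :: real)) at_top"
      by (intro filterlim_compose[OF exp_at_bot] filterlim_uminus_at_bot_at_top)
    show "\<forall>\<^sub>F T in at_top. norm (exp (- T) * W (x - c * T)) \<le> norm (exp (- T)) * B"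
      by (intro always_eventually) (auto simp: abs_mult bounded)
  qed
  then have "((\<lambda>T. \<Phi> T - \<Phi> 0) \<longlongrightarrow> W x) at_top"
    unfolding \<Phi>_def by (auto dest: tendsto_diff[OF tendsto_const[of "W x"]])
  ultimately show ?thesis
    using tendsto_unique[OF trivial_limit_at_top_linorder] by force
qed

lemma continuous_antiderivative:
  fixes g :: "real \<Rightarrow> real"
  assumes "continuous_on UNIV g"
  obtains P where "\<And>x. (P has_real_derivative g x) (at x)"
proof -
  have "\<exists>P. \<forall>x::real. -\<infinity> < ereal x \<longrightarrow> ereal x < \<infinity> \<longrightarrow> (P has_vector_derivative g x) (at x)"
    using assms by (intro einterval_antiderivative)
      (auto simp: continuous_on_eq_continuous_at)
  with that show ?thesis
    by (auto simp: has_real_derivative_iff_has_vector_derivative)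
qed

text \<open>Variation of constants: the substitution \<open>s = x - c * t\<close> moves
  \<open>x\<close> out of the argument of \<open>G\<close>, leaving
  \<open>exp (- (x / c)) / c\<close> times an integral of \<open>G s * exp (s / c)\<close> with
  endpoint \<open>x\<close>. This form can be differentiated although \<open>G\<close> is only
  continuous.\<close>

lemma exponential_average_deriv:
  fixes G H :: "real \<Rightarrow> real"
  assumes int: "\<And>x. has_bochner_integral lborel
      (\<lambda>t. exponential_density 1 t * G (x - c * t)) (H x)"
    and cont: "continuous_on UNIV G" and c: "c \<noteq> 0"
  shows "(H has_real_derivative (G x - H x) / c) (at x)"
proof -
  have "continuous_on UNIV (\<lambda>s. G s * exp (s / c))"
    using cont c by (auto intro!: continuous_intros)
  then obtain P where P: "\<And>s. (P has_real_derivative G s * exp (s / c)) (at s)"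
    using continuous_antiderivative by blast
  \<comment> \<open>The average truncated at \<open>T\<close> is
    \<open>exp (- (y / c)) / c * (P y - P (y - c * T))\<close>, so its convergence forces that of
    \<open>P (y - c * T)\<close>.\<close>
  have lim: "((\<lambda>T. P (y - c * T)) \<longlongrightarrow> P y - c * exp (y / c) * H y) at_top" for y
  proof -
    define \<Phi> where "\<Phi> t = - (exp (- (y / c)) / c * P (y - c * t))" for t
    have "((\<lambda>T. \<Phi> T - \<Phi> 0) \<longlongrightarrow> H y) at_top"
    proof (rule exponential_average_limit[OF int cont])
      fix t
      have "((\<lambda>t. P (y - c * t)) has_real_derivative
          G (y - c * t) * exp ((y - c * t) / c) * (- c)) (at t)"
        by (rule DERIV_chain2[OF P]) (auto intro!: derivative_eq_intros)
      then have "(\<Phi> has_real_derivative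
          - (exp (- (y / c)) / c * (G (y - c * t) * exp ((y - c * t) / c) * (- c)))) (at t)"
        unfolding \<Phi>_def by (intro DERIV_minus DERIV_cmult)
      also have "- (exp (- (y / c)) / c * (G (y - c * t) * exp ((y - c * t) / c) * (- c)))
          = exp (- (y / c) + (y - c * t) / c) * G (y - c * t)"
        unfolding exp_add using c by simp
      also have "- (y / c) + (y - c * t) / c = - t"
        using c by (simp add: field_simps)
      finally show "(\<Phi> has_real_derivative exp (- t) * G (y - c * t)) (at t)" .
    qed
    then have "((\<lambda>T. P y - c * exp (y / c) * (\<Phi> T - \<Phi> 0)) \<longlongrightarrow> P y - c * exp (y / c) * H y) at_top"
      by (intro tendsto_intros)
    moreover have "P y - c * exp (y / c) * (\<Phi> T - \<Phi> 0) = P (y - c * T)" for T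
      using c by (simp add: \<Phi>_def exp_minus field_simps)
    ultimately show ?thesis by simp
  qed
  \<comment> \<open>\<open>L\<close> is the limit of \<open>P\<close> at minus infinity if c > 0 and
    at plus infinity if c < 0. Shifting \<open>T\<close> by \<open>y / c\<close> shows that every
    \<open>y\<close> yields this same limit.\<close>
  define L where "L = P 0 - c * H 0"
  have H: "H y = exp (- (y / c)) * (P y - L) / c" for y
  proof -
    have "((\<lambda>T. P (y - c * (y / c + T))) \<longlongrightarrow> P y - c * exp (y / c) * H y) at_top"
      using filterlim_compose[OF lim filterlim_tendsto_add_at_top[OF tendsto_const filterlim_ident]] .
    then have "((\<lambda>T. P (0 - c * T)) \<longlongrightarrow> P y - c * exp (y / c) * H y) at_top"
      using c by (simp add: algebra_simps)
    with lim[of 0] have "P y - c * exp (y / c) * H y = L"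
      using tendsto_unique[OF trivial_limit_at_top_linorder] by (force simp: L_def)
    then show ?thesis using c by (simp add: exp_minus field_simps)
  qed
  have "((\<lambda>y. exp (- (y / c)) * (P y - L) / c) has_real_derivative
      (G x - exp (- (x / c)) * (P x - L) / c) / c) (at x)"
    using c by (auto intro!: derivative_eq_intros P simp: exp_minus field_simps)
  then show ?thesis using H by presburger
qed

lemma exponential_average_0:
  fixes G :: "real \<Rightarrow> real"
  assumes "has_bochner_integral lborel (\<lambda>t. exponential_density 1 t * G (x - 0 * t)) I"
    and "continuous_on UNIV G"
  shows "I = G x"
proof -
  define \<Phi> where "\<Phi> t = - exp (- t) * G x" for t
  have "((\<lambda>T. \<Phi> T - \<Phi> 0) \<longlongrightarrow> I) at_top"
    using assms by (rule exponential_average_limit)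
      (auto simp: \<Phi>_def intro!: derivative_eq_intros)
  moreover have "((\<lambda>T. exp (- T)) \<longlongrightarrow> (0 :: real)) at_top"
    by (intro filterlim_compose[OF exp_at_bot] filterlim_uminus_at_bot_at_top)
  then have "((\<lambda>T. \<Phi> T - \<Phi> 0) \<longlongrightarrow> - 0 * G x - - exp (- 0) * G x) at_top"
    unfolding \<Phi>_def by (intro tendsto_intros)
  ultimately show ?thesis
    using tendsto_unique[OF trivial_limit_at_top_linorder] by force
qed

section \<open>Inverting the chain rule, and quantiles of continuous distributions\<close>

text \<open>Differentiability of a merely continuous \<open>g\<close> is recovered from that of the
  composition: divide its difference quotient by the Caratheodory slope \<open>\<phi> (g y)\<close>,
  which tends to \<open>D\<close> and so is eventually nonzero. Below, \<open>g\<close> is the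
  distribution function and \<open>f\<close> is \<open>p\<close> or \<open>R\<close>.\<close>

lemma has_real_derivative_cancel:
  fixes f g :: "real \<Rightarrow> real"
  assumes g: "isCont g x" and f: "(f has_real_derivative D) (at (g x))" and D: "D \<noteq> 0"
    and fg: "((\<lambda>y. f (g y)) has_real_derivative E) (at x)"
  shows "(g has_real_derivative E / D) (at x)"
proof -
  obtain \<phi> where \<phi>: "\<And>z. f z - f (g x) = \<phi> z * (z - g x)" "isCont \<phi> (g x)" "\<phi> (g x) = D"
    using f unfolding CARAT_DERIV by blast
  have lim: "((\<lambda>y. \<phi> (g y)) \<longlongrightarrow> D) (at x)"
    using isCont_o2[OF g \<phi>(2)] \<phi>(3) by (simp add: isCont_def)
  then have ev: "\<forall>\<^sub>F y in at x. \<phi> (g y) \<noteq> 0"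
    using D by (rule tendsto_imp_eventually_ne)
  have "((\<lambda>y. (f (g y) - f (g x)) / (y - x) / \<phi> (g y)) \<longlongrightarrow> E / D) (at x)"
    using fg D lim by (intro tendsto_divide) (auto simp: has_field_derivative_iff)
  moreover have "\<forall>\<^sub>F y in at x. (f (g y) - f (g x)) / (y - x) / \<phi> (g y) = (g y - g x) / (y - x)"
    using ev by eventually_elim (simp add: \<phi>(1))
  ultimately show ?thesis
    unfolding has_field_derivative_iff by (rule Lim_transform_eventually)
qed

text \<open>The limits at both infinities make the set nonempty and bounded below, and continuity
  makes it closed, so the infimum is attained. The intermediate value theorem supplies a point of
  value exactly \<open>u\<close>, which bounds the value at the infimum from above.\<close>

lemma (in real_distribution)
  assumes cont: "continuous_on UNIV (cdf M)" and u: "0 < u" "u < 1"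
  shows quantile_le_iff: "quantile (cdf M) u \<le> x \<longleftrightarrow> u \<le> cdf M x"
    and cdf_quantile: "cdf M (quantile (cdf M) u) = u"
proof -
  let ?S = "{x. u \<le> cdf M x}"
  have "\<forall>\<^sub>F x in at_bot. cdf M x < u"
    using order_tendstoD(2)[OF cdf_lim_at_bot u(1)] .
  then obtain l where l: "cdf M l < u"
    by (auto simp: eventually_at_bot_linorder)
  have "\<forall>\<^sub>F x in at_top. u < cdf M x"
    using order_tendstoD(1)[OF cdf_lim_at_top_prob u(2)] .
  then obtain r where r: "u < cdf M r"
    by (auto simp: eventually_at_top_linorder)
  have lr: "l \<le> r"
    using l r cdf_nondecreasing[of r l] by linarith
  have bdd: "bdd_below ?S"
  proof (rule bdd_belowI)
    fix x assume "x \<in> ?S"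
    then show "l \<le> x" using l cdf_nondecreasing[of x l] by force
  qed
  have le: "quantile (cdf M) u \<le> x" if "u \<le> cdf M x" for x
    unfolding quantile_def using that bdd by (auto intro: cInf_lower)
  have "closed ?S"
    using cont by (intro closed_Collect_le) auto
  then have "quantile (cdf M) u \<in> ?S"
    unfolding quantile_def using bdd r by (intro closed_contains_Inf) (auto intro: less_imp_le)
  moreover obtain z where "cdf M z = u"
    using IVT'[of "cdf M" l u r] l r lr continuous_on_subset[OF cont] by auto
  then have "cdf M (quantile (cdf M) u) \<le> u"
    using cdf_nondecreasing[OF le[of z]] by simp
  ultimately show eq: "cdf M (quantile (cdf M) u) = u" by simp
  show "quantile (cdf M) u \<le> x \<longleftrightarrow> u \<le> cdf M x"
    using le eq cdf_nondecreasing[of "quantile (cdf M) u" x] by auto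
qed

section \<open>The functions of the separated equation and their boundary behaviour\<close>

locale max_shift =
  real_distribution N for N +
  fixes a b \<alpha> \<beta> d :: real
  assumes cont: "continuous_on UNIV (cdf N)"
    and a: "a \<ge> 0" and b: "b \<ge> 0" and ab: "(a, b) \<noteq> (0, 0)"
    and \<alpha>: "\<alpha> > 0" and \<beta>: "\<beta> > 0"
    and d: "d = (a * (\<alpha> + \<beta>) + b * \<alpha>) / \<beta>"
begin

abbreviation "F \<equiv> cdf N"
definition "p u = b * u powr \<alpha> + a * u powr (\<alpha> + \<beta>)" for u :: real
definition "p' u = b * \<alpha> * u powr (\<alpha> - 1) + a * (\<alpha> + \<beta>) * u powr (\<alpha> + \<beta> - 1)" for u :: real
definition "q u = u powr \<alpha> - u powr (\<alpha> + \<beta>)" for u :: real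
text \<open>On (0, 1) the exponential of \<open>R\<close> is the expression inside the logarithm of
  the theorem, with constant 1.\<close>

definition "R u = b * \<alpha> * ln u - d * ln (1 - u powr \<beta>)" for u :: real

lemma isCont_F: "isCont F x"
  using cont by (simp add: continuous_on_eq_continuous_at)

lemma isCont_F_powr: "s > 0 \<Longrightarrow> isCont (\<lambda>x. F x powr s) x"
  using isCont_F[of x] unfolding isCont_def
  by (intro tendsto_powr') (auto simp: cdf_nonneg)

lemma continuous_on_F_powr: "s > 0 \<Longrightarrow> continuous_on UNIV (\<lambda>x. F x powr s)"
  by (simp add: continuous_at_imp_continuous_on isCont_F_powr)

lemma d_pos: "d > 0"
proof -
  have "a * (\<alpha> + \<beta>) + b * \<alpha> > 0"
    using a b ab \<alpha> \<beta> by (cases "a = 0") (auto intro: add_pos_nonneg)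
  then show ?thesis using d \<beta> by simp
qed

lemma p_deriv: "0 < u \<Longrightarrow> (p has_real_derivative p' u) (at u)"
  unfolding p_def p'_def by (auto intro!: derivative_eq_intros)

lemma p'_pos: "0 < u \<Longrightarrow> 0 < p' u"
  unfolding p'_def using a b ab \<alpha> \<beta> by (cases "a = 0") (auto intro: add_nonneg_pos)

lemma powr_less_1: "0 < u \<Longrightarrow> u < 1 \<Longrightarrow> u powr \<beta> < 1" for u :: real
  using \<beta> powr_less_mono2[of \<beta> u 1] by simp

lemma q_eq: "q u = u powr \<alpha> * (1 - u powr \<beta>)"
  by (simp add: q_def powr_add algebra_simps)

lemma q_pos: "0 < u \<Longrightarrow> u < 1 \<Longrightarrow> 0 < q u"
  unfolding q_eq using powr_less_1 by simp

text \<open>This is where the value of \<open>d\<close> comes from. With w =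
  \<open>u powr \<beta>\<close>, the numerator
  \<open>b * \<alpha> * (1 - w) + d * \<beta> * w\<close> reduces to
  \<open>b * \<alpha> + a * (\<alpha> + \<beta>) * w\<close>, which is \<open>p' u\<close> divided
  by \<open>u powr (\<alpha> - 1)\<close>.\<close>

lemma R_deriv:
  assumes u: "0 < u" "u < 1"
  shows "(R has_real_derivative p' u / q u) (at u)"
proof -
  have 1: "1 - u powr \<beta> > 0" using powr_less_1[OF u] by simp
  have "(R has_real_derivative b * \<alpha> * (1 / u) - d * ((0 - \<beta> * u powr (\<beta> - 1)) / (1 - u powr \<beta>))) (at u)"
    unfolding R_def using u 1 by (auto intro!: derivative_eq_intros)
  also have "b * \<alpha> * (1 / u) - d * ((0 - \<beta> * u powr (\<beta> - 1)) / (1 - u powr \<beta>))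
      = (b * \<alpha> * (1 - u powr \<beta>) + d * \<beta> * u powr \<beta>) / (u * (1 - u powr \<beta>))"
  proof -
    have "x / u - d * ((0 - \<beta> * (w / u)) / v) = (x * v + d * \<beta> * w) / (u * v)"
      if "v \<noteq> 0" for v w x
      using u that by (simp add: field_simps)
    from this[of "1 - u powr \<beta>" "b * \<alpha>" "u powr \<beta>"] show ?thesis
      using u 1 \<beta> by (simp add: powr_diff)
  qed
  also have "d * \<beta> = a * (\<alpha> + \<beta>) + b * \<alpha>" using d \<beta> by simp
  also have "b * \<alpha> * (1 - u powr \<beta>) + (a * (\<alpha> + \<beta>) + b * \<alpha>) * u powr \<beta>
      = b * \<alpha> + a * (\<alpha> + \<beta>) * u powr \<beta>" by (simp add: algebra_simps)
  also have "\<dots> / (u * (1 - u powr \<beta>)) = p' u / q u"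
  proof -
    have "p' u = (b * \<alpha> + a * (\<alpha> + \<beta>) * u powr \<beta>) * (u powr \<alpha> / u)"
      using u by (simp add: p'_def powr_diff powr_add algebra_simps add_divide_distrib)
    then show ?thesis
      unfolding q_eq using u 1 by simp
  qed
  finally show ?thesis .
qed

text \<open>Serves to show that a distribution function with quantile \<open>R u + k\<close> never
  attains 1.\<close>

lemma R_at_left_1: "filterlim R at_top (at_left 1)"
proof -
  have ev: "\<forall>\<^sub>F u in at_left (1::real). u \<in> {0<..<1}"
    by (rule eventually_at_leftI[of 0]) auto
  have "((\<lambda>u::real. 1 - u powr \<beta>) \<longlongrightarrow> 1 - 1 powr \<beta>) (at_left 1)"
    by (intro tendsto_intros) auto
  then have "filterlim (\<lambda>u. 1 - u powr \<beta>) (at_right 0) (at_left 1)"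
    using ev powr_less_1 by (auto simp: filterlim_at elim!: eventually_mono)
  then have "filterlim (\<lambda>u. ln (1 - u powr \<beta>)) at_bot (at_left 1)"
    by (rule filterlim_compose[OF ln_at_0])
  then have "filterlim (\<lambda>u. - (d * ln (1 - u powr \<beta>))) at_top (at_left 1)"
    unfolding filterlim_uminus_at_bot[symmetric]
    by (intro filterlim_tendsto_pos_mult_at_bot[OF tendsto_const d_pos])
  moreover have "((\<lambda>u. b * \<alpha> * ln u) \<longlongrightarrow> b * \<alpha> * ln 1) (at_left (1::real))"
    by (intro tendsto_intros) auto
  ultimately show ?thesis
    unfolding R_def using filterlim_tendsto_add_at_top by fastforce
qed

lemma ln_term_at_right_0: "((\<lambda>u. d * ln (1 - u powr \<beta>)) \<longlongrightarrow> 0) (at_right 0)"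
proof -
  have "((\<lambda>u::real. u powr \<beta>) \<longlongrightarrow> 0) (at_right 0)"
    using \<beta> by (auto intro!: tendsto_eq_intros eventually_at_right_less simp: eventually_at_filter)
  then have "((\<lambda>u. d * ln (1 - u powr \<beta>)) \<longlongrightarrow> d * ln (1 - 0)) (at_right 0)"
    by (intro tendsto_intros) auto
  then show ?thesis by simp
qed

text \<open>Serves to show that for b > 0 such a distribution function never attains 0 either. For b
  = 0 the limit of \<open>R\<close> is 0 instead, and the support has a left end.\<close>

lemma R_at_right_0:
  assumes "b > 0"
  shows "filterlim R at_bot (at_right 0)"
proof -
  have "filterlim (\<lambda>u. b * \<alpha> * ln u) at_bot (at_right 0)"
    using assms \<alpha> by (intro filterlim_tendsto_pos_mult_at_bot[OF tendsto_const _ ln_at_0]) auto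
  then have "filterlim (\<lambda>u. - (b * \<alpha> * ln u)) at_top (at_right 0)"
    by (simp add: filterlim_uminus_at_bot)
  then have "filterlim (\<lambda>u. d * ln (1 - u powr \<beta>) + - (b * \<alpha> * ln u)) at_top (at_right 0)"
    by (rule filterlim_tendsto_add_at_top[OF ln_term_at_right_0])
  then show ?thesis
    by (simp add: R_def filterlim_uminus_at_bot algebra_simps)
qed

section \<open>The differential equation and the quantile function\<close>

text \<open>By monotonicity \<open>?S\<close> is an interval, so a zero derivative there gives a
  single constant. Evaluating at the quantile of \<open>u\<close>, where \<open>F\<close> equals
  \<open>u\<close>, turns the constancy into a formula for the quantile.\<close>

lemma ode_imp_quantile:
  assumes ode: "\<And>x. ((\<lambda>x. p (F x)) has_real_derivative q (F x)) (at x)"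
  shows "\<exists>k. \<forall>u. 0 < u \<and> u < 1 \<longrightarrow> quantile F u = R u + k"
proof -
  let ?S = "{x. 0 < F x \<and> F x < 1}"
  have "\<exists>k. \<forall>x\<in>?S. R (F x) - x = k"
  proof (rule has_field_derivative_zero_constant)
    have "is_interval ?S"
      unfolding is_interval_1 using cdf_nondecreasing by (force intro: less_le_trans le_less_trans)
    then show "convex ?S" by (rule is_interval_convex)
    fix x assume x: "x \<in> ?S"
    have "(F has_real_derivative q (F x) / p' (F x)) (at x)"
      using x p'_pos[of "F x"] by (intro has_real_derivative_cancel[OF isCont_F p_deriv _ ode]) auto
    with x have "((\<lambda>x. R (F x)) has_real_derivative p' (F x) / q (F x) * (q (F x) / p' (F x))) (at x)"
      by (intro DERIV_chain2[OF R_deriv]) auto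
    also have "p' (F x) / q (F x) * (q (F x) / p' (F x)) = 1"
      using x p'_pos[of "F x"] q_pos[of "F x"] by simp
    finally have "((\<lambda>x. R (F x) - x) has_real_derivative 1 - 1) (at x)"
      by (intro DERIV_diff DERIV_ident)
    then show "((\<lambda>x. R (F x) - x) has_real_derivative 0) (at x within ?S)"
      by (simp add: has_field_derivative_at_within)
  qed
  then obtain k where k: "\<And>x. x \<in> ?S \<Longrightarrow> R (F x) - x = k" by blast
  have "quantile F u = R u + (- k)" if "0 < u" "u < 1" for u
    using k[of "quantile F u"] cdf_quantile[OF cont that] that by simp
  then show ?thesis by blast
qed

text \<open>Where 0 < F < 1, the quantile formula makes \<open>R (F y) + k = y\<close>, and
  differentiating gives the equation. It has to hold on the whole line, however, so points with
  \<open>F x = 0\<close> are treated separately, while the value 1 is excluded.\<close>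

lemma quantile_imp_ode:
  assumes Q: "\<And>u. 0 < u \<Longrightarrow> u < 1 \<Longrightarrow> quantile F u = R u + k"
  shows "((\<lambda>x. p (F x)) has_real_derivative q (F x)) (at x)"
proof -
  have RF_le: "R u + k \<le> y \<longleftrightarrow> u \<le> F y" if "0 < u" "u < 1" for u y
    using quantile_le_iff[OF cont that] Q[OF that] by simp
  have RF: "R (F y) + k = y" if y: "0 < F y" "F y < 1" for y
  proof (rule antisym)
    show "R (F y) + k \<le> y" using RF_le[OF y] by simp
    \<comment> \<open>Every \<open>u\<close> above \<open>F y\<close> has its quantile
      \<open>R u + k\<close> to the right of \<open>y\<close>; let \<open>u\<close> decrease to
      \<open>F y\<close>.\<close>
    have "isCont R (F y)" using R_deriv[OF y] by (rule DERIV_isCont)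
    then have "((\<lambda>u. R u + k) \<longlongrightarrow> R (F y) + k) (at_right (F y))"
      by (intro tendsto_intros) (auto simp: isCont_def filterlim_at_split)
    moreover have "\<forall>\<^sub>F u in at_right (F y). y \<le> R u + k"
    proof (rule eventually_at_rightI[OF _ y(2)])
      fix u assume "u \<in> {F y<..<1}"
      then show "y \<le> R u + k" using RF_le[of u y] y by auto
    qed
    ultimately show "y \<le> R (F y) + k"
      by (rule tendsto_lowerbound) simp
  qed
  have F_less_1: "F y < 1" for y
  proof (rule ccontr)
    assume "\<not> F y < 1"
    then have le: "R u + k \<le> y" if "0 < u" "u < 1" for u
      using RF_le[OF that] that by simp
    have "\<forall>\<^sub>F u in at_left (1::real). u \<in> {0<..<1}"
      by (rule eventually_at_leftI[of 0]) auto
    then have "\<forall>\<^sub>F u in at_left 1. R u + k \<le> y"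
      by eventually_elim (simp add: le)
    moreover have "\<forall>\<^sub>F u in at_left 1. y - k < R u"
      using R_at_left_1 by (simp add: filterlim_at_top_dense)
    ultimately have "\<forall>\<^sub>F u in at_left (1::real). False"
      by eventually_elim simp
    then show False by simp
  qed
  show ?thesis
  proof (cases "F x = 0")
    case False
    then have x: "0 < F x" "F x < 1" using cdf_nonneg[of x] F_less_1 by auto
    have "((\<lambda>y. R (F y)) has_real_derivative 1) (at x)"
    proof (rule has_field_derivative_transform_within_open)
      show "((\<lambda>y. y - k) has_real_derivative 1) (at x)"
        by (auto intro!: derivative_eq_intros)
      show "open {y. 0 < F y \<and> F y < 1}"
        using cont by (intro open_Collect_conj open_Collect_less) auto
      show "y - k = R (F y)" if "y \<in> {y. 0 < F y \<and> F y < 1}" for y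
        using RF[of y] that by simp
    qed (use x in simp)
    then have "(F has_real_derivative 1 / (p' (F x) / q (F x))) (at x)"
      using x p'_pos[of "F x"] q_pos[of "F x"]
      by (intro has_real_derivative_cancel[OF isCont_F R_deriv]) auto
    with x have "((\<lambda>x. p (F x)) has_real_derivative p' (F x) * (1 / (p' (F x) / q (F x)))) (at x)"
      by (intro DERIV_chain2[OF p_deriv]) auto
    then show ?thesis using x p'_pos[of "F x"] by simp
  next
    \<comment> \<open>\<open>x\<close> lies at or to the left of the support of \<open>F\<close>, which is possible only for \<open>b = 0\<close>. There the
      separated equation is meaningless; instead \<open>F\<^sup>\<beta>\<close> grows at most linearly to the right of \<open>x\<close>, so
      \<open>p \<circ> F\<close>, a multiple of \<open>F\<^sup>\<alpha> F\<^sup>\<beta>\<close>, has derivative \<open>0\<close> at \<open>x\<close>.\<close>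
    case True
    then have x_less: "x < R u + k" if "0 < u" "u < 1" for u
      using RF_le[OF that, of x] that by simp
    have ev: "\<forall>\<^sub>F u in at_right (0::real). u \<in> {0<..<1}"
      by (rule eventually_at_rightI[of _ 1]) auto
    have b0: "b = 0"
    proof (rule ccontr)
      assume "b \<noteq> 0"
      then have "\<forall>\<^sub>F u in at_right 0. R u < x - k"
        using R_at_right_0 b by (simp add: filterlim_at_bot_dense)
      with ev have "\<forall>\<^sub>F u in at_right (0::real). False"
        by eventually_elim (use x_less in force)
      then show False by simp
    qed
    \<comment> \<open>Letting \<open>u\<close> decrease to 0 in \<open>x < R u + k\<close> places
      \<open>x\<close> at or to the left of \<open>k\<close>.\<close>
    have "((\<lambda>u. k - d * ln (1 - u powr \<beta>)) \<longlongrightarrow> k - 0) (at_right 0)"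
      by (intro tendsto_intros ln_term_at_right_0)
    moreover have "\<forall>\<^sub>F u in at_right 0. x \<le> k - d * ln (1 - u powr \<beta>)"
      using ev
    proof eventually_elim
      case (elim u)
      then have "x < R u + k" using x_less by simp
      then show ?case unfolding R_def by (simp add: b0)
    qed
    ultimately have "x \<le> k - 0"
      by (rule tendsto_lowerbound) simp
    then have xk: "x \<le> k" by simp
    \<comment> \<open>From \<open>ln (1 - w) \<le> - w\<close> with w =
      \<open>F y powr \<beta>\<close>: where \<open>F y > 0\<close>, d w is at most
      \<open>R (F y) = y - k\<close>, hence at most \<open>y - x\<close>.\<close>
    have bound: "F y powr \<beta> \<le> \<bar>y - x\<bar> / d" for y
    proof (cases "F y = 0")
      case False
      then have y: "0 < F y" "F y < 1" using cdf_nonneg[of y] F_less_1 by auto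
      have "ln (1 - F y powr \<beta>) \<le> - (F y powr \<beta>)"
        using ln_le_minus_one[of "1 - F y powr \<beta>"] powr_less_1[OF y] by simp
      then have "d * ln (1 - F y powr \<beta>) \<le> d * - (F y powr \<beta>)"
        using d_pos by (intro mult_left_mono) auto
      then have "d * F y powr \<beta> \<le> R (F y)"
        unfolding R_def by (simp add: b0)
      also have "\<dots> = y - k" using RF[OF y] by simp
      finally show ?thesis using xk d_pos by (simp add: field_simps)
    qed (use d_pos in simp)
    have "((\<lambda>y. (p (F y) - p (F x)) / (y - x)) \<longlongrightarrow> 0) (at x)"
    proof (rule tendsto_0_le[where K = "a / d"])
      show "((\<lambda>y. F y powr \<alpha>) \<longlongrightarrow> 0) (at x)"
        using isCont_F_powr[OF \<alpha>, of x] True by (simp add: isCont_def)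
      show "\<forall>\<^sub>F y in at x. norm ((p (F y) - p (F x)) / (y - x)) \<le> norm (F y powr \<alpha>) * (a / d)"
      proof (intro eventually_at_filter[THEN iffD2] always_eventually allI impI)
        fix y assume "y \<noteq> x"
        have "\<bar>p (F y) - p (F x)\<bar> = a * F y powr \<alpha> * F y powr \<beta>"
          unfolding p_def using True a by (simp add: b0 powr_add abs_mult)
        also have "\<dots> \<le> a * F y powr \<alpha> * (\<bar>y - x\<bar> / d)"
          using bound a by (intro mult_left_mono) auto
        finally show "norm ((p (F y) - p (F x)) / (y - x)) \<le> norm (F y powr \<alpha>) * (a / d)"
          using \<open>y \<noteq> x\<close> by (simp add: abs_divide divide_le_eq mult_ac)
      qed
    qed
    then show ?thesis
      using True by (simp add: has_field_derivative_iff q_def)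
  qed
qed

section \<open>Equality of the two averages as one differential equation\<close>

text \<open>Forward, the two equations for the common function are combined, a vanishing
  \<open>a\<close> or \<open>b\<close> being handled by the degenerate average. Backward,
  \<open>p (F x) / (a + b)\<close> is a bounded solution of both equations, so uniqueness identifies
  each average with it.\<close>

lemma averages_eq_iff:
  assumes H: "\<And>x. has_bochner_integral lborel
      (\<lambda>t. exponential_density 1 t * F (x - a * t) powr \<alpha>) (H x)"
    and K: "\<And>x. has_bochner_integral lborel
      (\<lambda>t. exponential_density 1 t * F (x - (- b) * t) powr (\<alpha> + \<beta>)) (K x)"
  shows "H = K \<longleftrightarrow> (\<forall>x. ((\<lambda>x. p (F x)) has_real_derivative q (F x)) (at x))"
proof
  note cont\<alpha> = continuous_on_F_powr[OF \<alpha>]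
  have cont\<alpha>\<beta>: "continuous_on UNIV (\<lambda>x. F x powr (\<alpha> + \<beta>))"
    using \<alpha> \<beta> by (simp add: continuous_on_F_powr)
  {
    assume eq: "H = K"
    have H': "(H has_real_derivative (F x powr \<alpha> - H x) / a) (at x)" if "a \<noteq> 0" for x
      using exponential_average_deriv[OF H cont\<alpha> that] .
    have K': "(H has_real_derivative (F x powr (\<alpha> + \<beta>) - H x) / (- b)) (at x)" if "b \<noteq> 0" for x
      using exponential_average_deriv[OF K cont\<alpha>\<beta>] that unfolding eq by simp
    have H0: "H x = F x powr \<alpha>" if "a = 0" for x
      using H[of x] cont\<alpha> unfolding that by (rule exponential_average_0)
    have K0: "H x = F x powr (\<alpha> + \<beta>)" if "b = 0" for x
      using K[of x] cont\<alpha>\<beta> unfolding that eq minus_zero by (rule exponential_average_0)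
    \<comment> \<open>If \<open>a\<close> and \<open>b\<close> are both nonzero, equate the two
      expressions for the derivative of \<open>H\<close>; otherwise \<open>H\<close> itself is
      already a power of \<open>F\<close>.\<close>
    have pH: "p (F x) = (a + b) * H x" for x
    proof (cases "a = 0 \<or> b = 0")
      case True
      then show ?thesis using H0[of x] K0[of x] by (auto simp: p_def)
    next
      case False
      then have "(F x powr \<alpha> - H x) / a = (F x powr (\<alpha> + \<beta>) - H x) / (- b)"
        using DERIV_unique[OF H' K'] by blast
      then show ?thesis using False by (simp add: p_def field_simps)
    qed
    have "((\<lambda>x. (a + b) * H x) has_real_derivative q (F x)) (at x)" for x
    proof (cases "a = 0")
      case True
      then have "b \<noteq> 0" using ab by simp
      from DERIV_cmult[OF K'[OF this], of "a + b" x] show ?thesis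
        using True \<open>b \<noteq> 0\<close> H0 by (simp add: q_def)
    next
      case False
      have "(a + b) * ((F x powr \<alpha> - H x) / a) = q (F x)"
        using False pH[of x] by (simp add: q_def p_def field_simps)
      with DERIV_cmult[OF H'[OF False], of "a + b" x] show ?thesis by simp
    qed
    then show "\<forall>x. ((\<lambda>x. p (F x)) has_real_derivative q (F x)) (at x)"
      by (simp add: pH)
  }
  {
    assume ode: "\<forall>x. ((\<lambda>x. p (F x)) has_real_derivative q (F x)) (at x)"
    define W where "W x = p (F x) / (a + b)" for x
    have ab_pos: "a + b > 0" using a b ab by auto
    have W': "(W has_real_derivative q (F x) / (a + b)) (at x)" for x
      unfolding W_def using ode by (intro DERIV_cdivide) auto
    have W_bounded: "\<bar>W x\<bar> \<le> 1" for x
    proof -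
      have "F x powr s \<le> 1" if "s > 0" for s
        using powr_mono2[of s "F x" 1] cdf_nonneg[of x] cdf_bounded_prob[of x] that by simp
      then have "p (F x) \<le> b * 1 + a * 1"
        unfolding p_def using a b \<alpha> \<beta> by (intro add_mono mult_left_mono) auto
      moreover have "0 \<le> p (F x)"
        unfolding p_def using a b by simp
      ultimately show ?thesis using ab_pos by (simp add: W_def)
    qed
    have W_eq: "W y + c * (q (F y) / (a + b)) = (p (F y) + c * q (F y)) / (a + b)" for c y
      by (simp add: W_def add_divide_distrib)
    have pq: "p (F y) + a * q (F y) = (a + b) * F y powr \<alpha>"
        "p (F y) + (- b) * q (F y) = (a + b) * F y powr (\<alpha> + \<beta>)" for y
      by (simp_all add: p_def q_def algebra_simps)
    have "W y + a * (q (F y) / (a + b)) = F y powr \<alpha>"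
        "W y + (- b) * (q (F y) / (a + b)) = F y powr (\<alpha> + \<beta>)" for y
      unfolding W_eq pq using ab_pos by simp_all
    then have "H x = W x" "K x = W x" for x
      using exponential_average_unique[OF H cont\<alpha> W' _ W_bounded]
        exponential_average_unique[OF K cont\<alpha>\<beta> W' _ W_bounded] by blast+
    then show "H = K" by auto
  }
qed

end

section \<open>The characterization for the random variables\<close>

theorem theorem3:
  fixes a b \<alpha> \<beta> d :: real
    and F :: "real \<Rightarrow> real"
    and N :: "real measure"
    and M :: "'a measure"
    and Y1 Y2 \<xi>1 \<xi>2 :: "'a \<Rightarrow> real"
  assumes "a \<ge> 0" and "b \<ge> 0" and "(a, b) \<noteq> (0, 0)"
    and "real_distribution N" and "F = cdf N" and "continuous_on UNIV F"
    and "\<alpha> > 0" and "\<beta> > 0"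
    and "prob_space M"
    and "prob_space.indep_var M borel Y1 borel Y2"
    and "\<And>x. cdf (distr M borel Y1) x = F x powr \<alpha>"
    and "\<And>x. cdf (distr M borel Y2) x = F x powr \<beta>"
    and "prob_space.indep_var M borel \<xi>1 borel \<xi>2"
    and "distributed M lborel \<xi>1 (exponential_density 1)"
    and "distributed M lborel \<xi>2 (exponential_density 1)"
    and "prob_space.indep_var M borel \<xi>1 borel Y1"
    and "prob_space.indep_var M borel \<xi>2 borel (\<lambda>\<omega>. max (Y1 \<omega>) (Y2 \<omega>))"
    and "d = (a * (\<alpha> + \<beta>) + b * \<alpha>) / \<beta>"
  shows "distr M borel (\<lambda>\<omega>. Y1 \<omega> + a * \<xi>1 \<omega>) =
           distr M borel (\<lambda>\<omega>. max (Y1 \<omega>) (Y2 \<omega>) - b * \<xi>2 \<omega>) \<longleftrightarrow>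
         (\<exists>c>0. \<forall>x. 0 < x \<and> x < 1 \<longrightarrow>
           quantile F x = ln (c * x powr (b * \<alpha>) * (1 - x powr \<beta>) powr (- d)))"
proof -
  interpret max_shift N a b \<alpha> \<beta> d
    using assms(1-8,18) by (auto intro!: max_shift.intro simp: max_shift_axioms_def)
  interpret M: prob_space M by fact
  have [measurable]: "Y1 \<in> borel_measurable M" "Y2 \<in> borel_measurable M"
      "\<xi>1 \<in> borel_measurable M" "\<xi>2 \<in> borel_measurable M"
    using assms(10,13) by (auto simp: M.indep_var_distribution_eq)
  have F: "F = cdf N" by fact
  let ?U = "distr M borel (\<lambda>\<omega>. Y1 \<omega> + a * \<xi>1 \<omega>)"
  let ?V = "distr M borel (\<lambda>\<omega>. max (Y1 \<omega>) (Y2 \<omega>) + (- b) * \<xi>2 \<omega>)"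
  have "?U = ?V \<longleftrightarrow> cdf ?U = cdf ?V"
    by (auto intro!: cdf_unique)
  also have "\<dots> \<longleftrightarrow> (\<forall>x. ((\<lambda>x. p (cdf N x)) has_real_derivative q (cdf N x)) (at x))"
  proof (rule averages_eq_iff)
    show "has_bochner_integral lborel
        (\<lambda>t. exponential_density 1 t * cdf N (x - a * t) powr \<alpha>) (cdf ?U x)" for x
      using M.cdf_add_exponential[OF assms(16,14), where c = a and x = x] by (simp add: assms(11) F)
    show "has_bochner_integral lborel
        (\<lambda>t. exponential_density 1 t * cdf N (x - (- b) * t) powr (\<alpha> + \<beta>)) (cdf ?V x)" for x
      using M.cdf_add_exponential[OF assms(17,15), where c = "- b" and x = x]
      by (simp add: M.cdf_max_indep[OF assms(10)] assms(11,12) F powr_add)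
  qed
  also have "\<dots> \<longleftrightarrow> (\<exists>k. \<forall>u. 0 < u \<and> u < 1 \<longrightarrow> quantile (cdf N) u = R u + k)"
    using ode_imp_quantile quantile_imp_ode by blast
  also have "\<dots> \<longleftrightarrow> (\<exists>c>0. \<forall>u. 0 < u \<and> u < 1 \<longrightarrow> quantile (cdf N) u = R u + ln c)"
    \<comment> \<open>The additive constant \<open>k\<close> corresponds to the factor c = exp
      k.\<close>
    by (metis exp_gt_zero ln_exp)
  also have "\<dots> \<longleftrightarrow> (\<exists>c>0. \<forall>u. 0 < u \<and> u < 1 \<longrightarrow>
      quantile F u = ln (c * u powr (b * \<alpha>) * (1 - u powr \<beta>) powr (- d)))"
  proof -
    have "R u + ln c = ln (c * u powr (b * \<alpha>) * (1 - u powr \<beta>) powr (- d))"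
      if "0 < u" "u < 1" "0 < c" for u c
      using that powr_less_1[of u] \<beta> by (simp add: R_def ln_mult ln_powr)
    then show ?thesis unfolding F by (metis (no_types, lifting))
  qed
  finally show ?thesis by simp
qed

end
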